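(* For all non-negative integers $n$ and $l$, $$\sum_{k=0}^{2n}(-1)^k\binom{2n}{k}S(k,l)\,S(2n-k,l)=S(n,l)\,S(n+l,n).$$
   Context: For non-negative integers $a$ and $b$, the super Catalan number is $S(a,b)=\dfrac{\binom{2a}{a}\binom{2b}{b}}{\binom{a+b}{a}}=\dfrac{(2a)!\,(2b)!}{a!\,b!\,(a+b)!}$; it is always an integer. *)

theory Defs
  imports Complex_Main
begin

text \<open>Rational-valued, so that the quotient is exact division; the values are integers
  by \<open>super_catalan_Ints\<close>.\<close>

definition super_catalan :: "nat \<Rightarrow> nat \<Rightarrow> rat" where
  "super_catalan a b =
     of_nat ((2 * a) choose a) * of_nat ((2 * b) choose b) / of_nat ((a + b) choose a)"

lemma super_catalan_fact:
  "super_catalan a b = fact (2 * a) * fact (2 * b) / (fact a * fact b * fact (a + b))"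
proof -
  have *: "of_nat ((2 * m) choose m) = (fact (2 * m) / (fact m * fact m) :: rat)" for m
    by (subst binomial_fact) (auto simp: mult_2)
  have **: "of_nat ((a + b) choose a) = (fact (a + b) / (fact a * fact b) :: rat)"
    by (subst binomial_fact) auto
  show ?thesis
    unfolding super_catalan_def * ** by simp
qed

lemma super_catalan_rec:
  "super_catalan (Suc a) b = 4 * super_catalan a b - super_catalan a (Suc b)"
proof -
  have "fact (2 * Suc m) = (2 * of_nat m + 2) * (2 * of_nat m + 1) * (fact (2 * m) :: rat)" for m
    by (simp add: algebra_simps)
  moreover have "of_nat a + 1 \<noteq> (0 :: rat)" "of_nat b + 1 \<noteq> (0 :: rat)"
    "of_nat a + of_nat b + 1 \<noteq> (0 :: rat)"
    by (metis of_nat_Suc of_nat_neq_0 add.commute,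
        metis of_nat_Suc of_nat_neq_0 add.commute,
        metis of_nat_Suc of_nat_add of_nat_neq_0 add.commute)
  moreover have "fact (Suc m) = (of_nat m + 1) * (fact m :: rat)" for m
    by (simp add: algebra_simps)
  ultimately show ?thesis
    unfolding super_catalan_fact add_Suc add_Suc_right
    by (simp add: divide_simps del: fact_Suc mult_Suc_right) (simp add: algebra_simps)
qed

lemma super_catalan_Ints: "super_catalan a b \<in> \<int>"
proof (induction a arbitrary: b)
  case 0
  show ?case by (simp add: super_catalan_def)
next
  case (Suc a)
  then show ?case by (simp add: super_catalan_rec)
qed

end

theory Submission
  imports Defs
begin

text \<open>Up to a constant the sum is \<open>\<Sum>k\<le>2n. (-1)^k u(k) u(2n-k)\<close> with
  \<open>u(k) = (2k)! / (k!\<^sup>2 (k+l)!)\<close>, a terminating well-poised hypergeometric series as in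
  Dixon's theorem. Creative telescoping gives a first-order recurrence in \<open>n\<close> for it; the
  certificate is \<open>(-1)^k u(k) u(2n+1-k)\<close> times a quadratic polynomial that is symmetric under
  \<open>k \<mapsto> 2n+1-k\<close>. The right-hand side satisfies the same recurrence.\<close>

text \<open>The \<open>u(k)\<close> above: \<open>super_catalan k l\<close> divided by
  \<open>fact k\<close> and by a factor free of \<open>k\<close>. The division by
  \<open>fact k\<close> turns the binomial weight in the sum into the constant
  \<open>fact (2 * n)\<close>.\<close>

definition coef :: "nat \<Rightarrow> nat \<Rightarrow> rat" where
  "coef l k = fact (2 * k) / (fact k ^ 2 * fact (k + l))"

definition alt_conv :: "nat \<Rightarrow> nat \<Rightarrow> rat" where
  "alt_conv l n = (\<Sum>k\<le>2 * n. (-1) ^ k * coef l k * coef l (2 * n - k))"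

lemma of_nat_add_1_neq_0: "of_nat m + 1 \<noteq> (0 :: rat)"
  by (metis of_nat_Suc of_nat_neq_0 add.commute)

lemma of_nat_add_add_1_neq_0: "of_nat m + of_nat l + 1 \<noteq> (0 :: rat)"
  by (metis of_nat_add of_nat_add_1_neq_0)

lemma fact_double_Suc:
  "fact (2 * Suc m) = (2 * of_nat m + 2) * (2 * of_nat m + 1) * (fact (2 * m) :: rat)"
  by (simp add: algebra_simps)

lemma fact_Suc_rat: "fact (Suc m) = (of_nat m + 1) * (fact m :: rat)"
  by (simp add: algebra_simps)

lemma coef_Suc:
  "coef l (Suc k) =
     coef l k * (2 * (2 * of_nat k + 1)) / ((of_nat k + 1) * (of_nat k + of_nat l + 1))"
  unfolding coef_def fact_double_Suc add_Suc fact_Suc_rat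
  using of_nat_add_1_neq_0[of k] of_nat_add_add_1_neq_0[of k l]
  by (simp add: divide_simps power2_eq_square del: fact_Suc) (simp add: algebra_simps)

text \<open>The telescoping step with denominators cleared. After division by the common term, only
  the ratios \<open>coef l (Suc k) / coef l k\<close> and \<open>coef l (Suc d) / coef l d\<close>
  remain, and a polynomial identity is left.\<close>

lemma certificate_identity:
  fixes n l k d :: "'a :: comm_ring_1"
  assumes "k + d = 2 * n"
  defines "Q \<equiv> \<lambda>x. (4*n + 3) * (n+l+1) * (2*n+l+1) + (2*n+1) * x * (2*n+1 - x)"
  shows "(n+1) * (n+l+1) * (2*n+l+1) * (2*n+l+2) * ((2 * (2*k+1)) * (2 * (2*d+1)))
       + 4 * (2*n+1) * (2*n+2*l+1) * (((k+1) * (k+l+1)) * ((d+1) * (d+l+1)))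
       = Q (k+1) * (2 * (2*k+1)) * ((d+1) * (d+l+1)) + Q k * (2 * (2*d+1)) * ((k+1) * (k+l+1))"
proof -
  have d: "d = 2 * n - k"
    using assms(1) by (simp add: algebra_simps)
  show ?thesis
    unfolding Q_def d by (simp add: algebra_simps)
qed

lemma alt_conv_rec:
  fixes n l :: nat
  defines "N \<equiv> of_nat n :: rat" and "L \<equiv> of_nat l :: rat"
  shows "(N+1) * (N+L+1) * (2*N+L+1) * (2*N+L+2) * alt_conv l (Suc n)
       = 4 * (2*N+1) * (2*N+2*L+1) * alt_conv l n"
proof -
  define A where "A = (N+1) * (N+L+1) * (2*N+L+1) * (2*N+L+2)"
  define B where "B = 4 * (2*N+1) * (2*N+2*L+1)"
  define Q where "Q = (\<lambda>x. (4*N + 3) * (N+L+1) * (2*N+L+1) + (2*N+1) * x * (2*N+1 - x))"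
  define t where "t = (\<lambda>k. (-1) ^ k * coef l k * coef l (2 * n - k))"
  define t' where "t' = (\<lambda>k. (-1) ^ k * coef l k * coef l (2 * Suc n - k))"
  define h where "h = (\<lambda>k. (-1) ^ k * Q (of_nat k) * coef l k * coef l (2 * n + 1 - k))"
  \<comment> \<open>The shift pairs indices \<open>(k, d)\<close> with \<open>(k+1, d+1)\<close>,
    where \<open>k + d = 2n\<close>, so both factors grow by one and the symmetry between
    \<open>k\<close> and \<open>d\<close> survives.\<close>
  have step: "A * t' (Suc k) - B * t k = h (Suc k) - h k" if k: "k \<le> 2 * n" for k
  proof -
    obtain d where d: "2 * n = k + d"
      using le_Suc_ex[OF k] by auto
    define x y :: rat where "x = of_nat k" and "y = of_nat d"
    have "of_nat (2 * n) = (of_nat (k + d) :: rat)"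
      using d by simp
    hence xy: "x + y = 2 * N"
      by (simp add: x_def y_def N_def)
    have idx: "2 * n - k = d" "2 * Suc n - Suc k = Suc d"
      "2 * n + 1 - k = Suc d" "2 * n + 1 - Suc k = d"
      using d by auto
    define px qx py qy where "px = 2 * (2*x+1)" and "qx = (x+1) * (x+L+1)"
      and "py = 2 * (2*y+1)" and "qy = (y+1) * (y+L+1)"
    note p = this
    have nz: "qx \<noteq> 0" "qy \<noteq> 0"
      using of_nat_add_1_neq_0[of k] of_nat_add_1_neq_0[of d]
        of_nat_add_add_1_neq_0[of k l] of_nat_add_add_1_neq_0[of d l]
      by (auto simp: p x_def y_def L_def)
    have ck: "coef l (Suc k) = coef l k * px / qx" and cd: "coef l (Suc d) = coef l d * py / qy"
      by (simp_all add: coef_Suc p x_def y_def L_def)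
    have "A * (px * py) + B * (qx * qy) = Q (x+1) * px * qy + Q x * py * qx"
      using certificate_identity[OF xy, of L] unfolding A_def B_def Q_def p .
    hence "A * (px * py) / (qx * qy) + B = Q (x+1) * px / qx + Q x * py / qy"
      using nz by (simp add: divide_simps)
    \<comment> \<open>Both sides are the negatives of those of \<open>step\<close>: the sign of
      index \<open>k+1\<close> is opposite to that of \<open>k\<close>.\<close>
    hence "(-1) ^ k * coef l k * coef l d * (A * (px * py) / (qx * qy) + B)
         = (-1) ^ k * coef l k * coef l d * (Q (x+1) * px / qx + Q x * py / qy)"
      by simp
    thus ?thesis
      unfolding t_def t'_def h_def idx ck cd of_nat_Suc
      by (simp add: algebra_simps flip: x_def)
  qed
  \<comment> \<open>The constant term of \<open>Q\<close> is exactly \<open>A\<close> times the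
    ratio of these two coefficients; this makes the boundary terms cancel.\<close>
  have end_coef: "A * coef l (2 * n + 2) = Q 0 * coef l (2 * n + 1)"
    using of_nat_add_1_neq_0[of "2 * n + 1"] of_nat_add_add_1_neq_0[of "2 * n + 1" l]
      coef_Suc[of l "2 * n + 1"]
    by (simp add: A_def Q_def N_def L_def divide_simps) (simp add: algebra_simps)
  have Q_sym: "Q (of_nat (2 * n + 1)) = Q 0"
    by (simp add: Q_def N_def)
  have left_end: "A * t' 0 = h 0"
    using end_coef by (simp add: t'_def h_def mult_ac)
  have right_end: "A * t' (2 * n + 2) = - h (2 * n + 1)"
    using end_coef unfolding t'_def h_def Q_sym by (simp add: mult_ac)
  \<comment> \<open>\<open>step\<close> covers the indices 1 to \<open>2n+1\<close> of
    \<open>t'\<close>; the two outermost terms are split off and cancel against the boundary values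
    of \<open>h\<close>.\<close>
  have "A * alt_conv l (Suc n) = A * (\<Sum>k\<le>Suc (Suc (2 * n)). t' k)"
    by (simp add: alt_conv_def t'_def)
  also have "\<dots> = A * t' 0 + A * (\<Sum>k\<le>2 * n. t' (Suc k)) + A * t' (2 * n + 2)"
    by (subst sum.atMost_Suc, subst sum.atMost_Suc_shift) (simp add: algebra_simps)
  also have "A * (\<Sum>k\<le>2 * n. t' (Suc k)) = (\<Sum>k\<le>2 * n. h (Suc k) - h k + B * t k)"
    unfolding sum_distrib_left using step by (intro sum.cong) (auto simp: algebra_simps)
  also have "\<dots> = h (2 * n + 1) - h 0 + B * alt_conv l n"
    using sum_telescope[of "\<lambda>k. - h k" "2 * n"]
    by (simp add: sum.distrib alt_conv_def t_def sum_distrib_left)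
  finally show ?thesis
    unfolding left_end right_end by (simp add: A_def B_def)
qed

text \<open>The value is the right-hand side of the theorem divided by \<open>fact (2 * n)\<close>
  and the square of \<open>fact (2 * l) / fact l\<close>. It follows by induction, since the leading
  coefficient of the recurrence never vanishes.\<close>

lemma alt_conv_closed_form:
  "alt_conv l n = fact l * fact (2 * n) * fact (2 * (n + l)) /
     (fact (2 * l) * fact n ^ 2 * fact (n + l) ^ 2 * fact (2 * n + l))"
proof (induction n)
  case 0
  show ?case
    by (simp add: alt_conv_def coef_def power2_eq_square)
next
  case (Suc n)
  define N L :: rat where "N = of_nat n" and "L = of_nat l"
  define a b c e p q where "a = N + 1" and "b = 2 * N + 1" and "c = 2 * N + 2 * L + 1"
    and "e = N + L + 1" and "p = 2 * N + L + 1" and "q = 2 * N + L + 2"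
  note defs = this
  have nz: "a \<noteq> 0" "e \<noteq> 0" "p \<noteq> 0" "q \<noteq> 0"
    using of_nat_add_1_neq_0[of n] of_nat_add_add_1_neq_0[of n l]
      of_nat_add_add_1_neq_0[of "2 * n" l] of_nat_add_add_1_neq_0[of "2 * n + 1" l]
    by (simp_all add: defs N_def L_def add_ac)
  have "a * e * p * q * alt_conv l (Suc n) = 4 * b * c * alt_conv l n"
    using alt_conv_rec[of n l, folded N_def L_def] by (simp only: defs)
  hence rec: "alt_conv l (Suc n) = 4 * b * c * alt_conv l n / (a * e * p * q)"
    using nz by (subst eq_divide_eq) (simp add: mult.commute)
  have f1: "fact (2 * Suc n + l) = q * p * (fact (2 * n + l) :: rat)"
    by (simp add: defs N_def L_def algebra_simps)
  have f2: "fact (2 * (Suc n + l)) = 2 * e * c * (fact (2 * (n + l)) :: rat)"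
    unfolding add_Suc fact_double_Suc by (simp add: defs N_def L_def algebra_simps)
  have f3: "fact (Suc n + l) = e * (fact (n + l) :: rat)"
    unfolding add_Suc fact_Suc_rat by (simp add: defs N_def L_def)
  have f4: "fact (2 * Suc n) = 2 * a * b * (fact (2 * n) :: rat)"
    unfolding fact_double_Suc by (simp add: defs N_def algebra_simps)
  have f5: "fact (Suc n) = a * (fact n :: rat)"
    unfolding fact_Suc_rat by (simp add: defs N_def)
  show ?case
    unfolding rec Suc f1 f2 f3 f4 f5 using nz
    by (simp add: power2_eq_square mult_ac)
qed

lemma super_catalan_coef: "super_catalan k l = fact (2 * l) / fact l * (fact k * coef l k)"
  by (simp add: super_catalan_fact coef_def power2_eq_square mult_ac)

theorem theorem1:
  fixes n l :: nat
  shows "(\<Sum>k = 0..2 * n. (-1) ^ k * of_nat ((2 * n) choose k)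
            * super_catalan k l * super_catalan (2 * n - k) l)
         = super_catalan n l * super_catalan (n + l) n"
proof -
  define c :: rat where "c = fact (2 * l) / fact l"
  have "(\<Sum>k = 0..2 * n. (-1) ^ k * of_nat ((2 * n) choose k)
            * super_catalan k l * super_catalan (2 * n - k) l)
      = (\<Sum>k\<le>2 * n. c ^ 2 * fact (2 * n) * ((-1) ^ k * coef l k * coef l (2 * n - k)))"
  proof (intro sum.cong)
    \<comment> \<open>The factors \<open>fact k\<close> and \<open>fact (2 * n - k)\<close> from the
      two super Catalan numbers cancel the denominator of the binomial coefficient.\<close>
    fix k assume "k \<in> {..2 * n}"
    hence "of_nat ((2 * n) choose k) = (fact (2 * n) / (fact k * fact (2 * n - k)) :: rat)"
      by (intro binomial_fact) simp
    thus "(-1) ^ k * of_nat ((2 * n) choose k) * super_catalan k l * super_catalan (2 * n - k) l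
        = c ^ 2 * fact (2 * n) * ((-1) ^ k * coef l k * coef l (2 * n - k))"
      by (simp add: super_catalan_coef c_def power2_eq_square)
  qed (simp add: atMost_atLeast0)
  also have "\<dots> = c ^ 2 * fact (2 * n) * alt_conv l n"
    by (simp add: alt_conv_def sum_distrib_left)
  also have "\<dots> = super_catalan n l * super_catalan (n + l) n"
  proof -
    have idx: "n + l + n = 2 * n + l"
      by simp
    show ?thesis
      unfolding alt_conv_closed_form super_catalan_fact c_def idx
      by (simp add: divide_simps power2_eq_square)
  qed
  finally show ?thesis .
qed

end
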